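(* Let $G$ be a stable system with impulse response $G(t)=Ce^{At}B$, $t\ge 0$, where $A\in\mathbb R^{n\times n}$, $B\in\mathbb R^{n\times p}$, $C\in\mathbb R^{m\times n}$. Then $\mathcal M_0(G)=\sup_{t\ge0}\overline{\sigma}(Ce^{At}B)$ is an induced system norm: for vector inputs $w$ satisfying $$\int_0^\infty |w(t)|_2\,dt=\int_0^\infty\Big(\sum_{k=1}^p|w_k(t)|^2\Big)^{1/2}dt=1,$$ it measures the output $z=G\ast w$ by the vector signal norm $$\sup_{t\ge0}\|z(t)\|_2=\sup_{t\ge0}\Big(\sum_{i=1}^m|z_i(t)|^2\Big)^{1/2}.$$ That is, $$\mathcal M_0(G)=\sup_{w\neq0}\frac{\|G\ast w\|_{\infty,2}}{\|w\|_{1,2}},$$ where the supremum is over nonzero $w\in L^1([0,\infty),\mathbb R^p)$.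
   Context: $\overline{\sigma}$ is the maximum singular value. Stable means that all eigenvalues of $A$ have negative real part. $(G\ast w)(t)=\int_0^t Ce^{A(t-\tau)}Bw(\tau)\,d\tau$. The vector signal norms are $\|w\|_{1,2}=\int_0^\infty|w(t)|_2\,dt$ and $\|z\|_{\infty,2}=\sup_{t\ge0}|z(t)|_2$, where $|\cdot|_2$ is the Euclidean norm. *)

theory Defs
  imports "HOL-Analysis.Analysis"
begin

text \<open>
  The ring operations, and hence \<open>^\<close> and \<open>exp\<close>, act componentwise on \<open>real ^ 'n ^ 'n\<close>.
  The power series of the exponential is therefore written with the matrix product \<open>**\<close>.
\<close>

definition mat_pow :: "real ^ 'n ^ 'n \<Rightarrow> nat \<Rightarrow> real ^ 'n ^ 'n" where
  "mat_pow A k = (((**) A) ^^ k) (mat 1)"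

definition mat_exp :: "real ^ 'n ^ 'n \<Rightarrow> real ^ 'n ^ 'n" where
  "mat_exp A = (\<Sum>k. mat_pow A k /\<^sub>R fact k)"

definition mat_eigenvalue :: "('a::field) ^ 'n ^ 'n \<Rightarrow> 'a \<Rightarrow> bool" where
  "mat_eigenvalue A \<mu> \<longleftrightarrow> (\<exists>v. v \<noteq> 0 \<and> A *v v = \<mu> *s v)"

text \<open>Eigenvalues of a real matrix are taken over the complex numbers.\<close>

definition stable_matrix :: "real ^ 'n ^ 'n \<Rightarrow> bool" where
  "stable_matrix A \<longleftrightarrow>
    (\<forall>\<mu>. mat_eigenvalue (\<chi> i j. complex_of_real (A $ i $ j)) \<mu> \<longrightarrow> Re \<mu> < 0)"

text \<open>
  \<open>M\<^sup>T M\<close> is symmetric and positive semidefinite, so its eigenvalues are real and nonnegative.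
  For \<open>M\<close> with more columns than rows this set may contain an extra \<open>0\<close> compared with the
  convention of \<open>min m p\<close> singular values; the maximum is the same.
\<close>

definition singular_values :: "real ^ 'p ^ 'm \<Rightarrow> real set" where
  "singular_values M = {sqrt \<mu> | \<mu>. mat_eigenvalue (transpose M ** M) \<mu>}"

definition max_singular_value :: "real ^ 'p ^ 'm \<Rightarrow> real" where
  "max_singular_value M = Max (singular_values M)"

definition impulse_response ::
  "real ^ 'n ^ 'n \<Rightarrow> real ^ 'p ^ 'n \<Rightarrow> real ^ 'n ^ 'm \<Rightarrow> real \<Rightarrow> real ^ 'p ^ 'm" where
  "impulse_response A B C t = C ** mat_exp (t *\<^sub>R A) ** B"

definition system_output ::
  "(real \<Rightarrow> real ^ 'p ^ 'm) \<Rightarrow> (real \<Rightarrow> real ^ 'p) \<Rightarrow> real \<Rightarrow> real ^ 'm" where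
  "system_output G w t = (LINT \<tau>:{0..t}|lebesgue. G (t - \<tau>) *v w \<tau>)"

text \<open>Suprema are taken in \<open>ereal\<close>, so that unboundedness shows up as the value \<open>\<infinity>\<close>.\<close>

definition M0 :: "(real \<Rightarrow> real ^ 'p ^ 'm) \<Rightarrow> ereal" where
  "M0 G = (SUP t\<in>{0..}. ereal (max_singular_value (G t)))"

definition norm_inf2 :: "(real \<Rightarrow> real ^ 'm) \<Rightarrow> ereal" where
  "norm_inf2 z = (SUP t\<in>{0..}. ereal (norm (z t)))"

definition L1_signals :: "(real \<Rightarrow> real ^ 'p) set" where
  "L1_signals = {w. set_integrable lebesgue {0..} w}"

definition norm_12 :: "(real \<Rightarrow> real ^ 'p) \<Rightarrow> real" where
  "norm_12 w = (LINT t:{0..}|lebesgue. norm (w t))"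

text \<open>Nonzero as an element of \<open>L\<^sup>1\<close>, i.e. up to equality almost everywhere on the half-line.\<close>

definition nonzero_signal :: "(real \<Rightarrow> real ^ 'p) \<Rightarrow> bool" where
  "nonzero_signal w \<longleftrightarrow> \<not> (AE t in lebesgue. t \<in> {0..} \<longrightarrow> w t = 0)"

end

theory Submission
  imports Defs "HOL-Computational_Algebra.Fundamental_Theorem_Algebra"
begin

text \<open>
  The largest singular value is the operator norm for the Euclidean norms, so
  \<open>|z(t)| \<le> \<integral> |G(t - \<tau>) w(\<tau>)| d\<tau> \<le> M0(G) \<parallel>w\<parallel>\<close>. Conversely, if \<open>v\<close> is a unit vector on which
  \<open>G t\<close> attains its norm, the output at time \<open>t + h\<close> for the pulse of height \<open>1 / h\<close> on
  \<open>[0, h]\<close> in direction \<open>v\<close> tends to \<open>G t v\<close> as \<open>h\<close> tends to \<open>0\<close>.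

  Finiteness of \<open>M0(G)\<close> needs boundedness of \<open>exp(tA)\<close>. A curve with \<open>x' = A x\<close> is killed by a
  nonzero polynomial in \<open>A\<close>; split off one linear factor \<open>A - \<mu>\<close> and let \<open>y = (A - \<mu>) x\<close>, which
  is bounded by induction on the degree. If \<open>\<mu>\<close> is an eigenvalue, then \<open>x' = \<mu> x + y\<close> with
  \<open>Re \<mu> < 0\<close> bounds \<open>x\<close>; otherwise \<open>A - \<mu>\<close> is invertible and \<open>x\<close> is bounded with \<open>y\<close>.
\<close>

subsection \<open>Bounded solutions of stable linear systems\<close>

text \<open>Integrating factor: with \<open>a = - Re \<mu>\<close>, the function exp(-\<mu> s) f(s)
  has derivative exp(-\<mu> s) g(s), of norm at most K exp(a s). Integrating from 0 to t and
  dividing by exp(a t) gives the bound.\<close>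

lemma scalar_stable_ode_bounded:
  fixes f g :: "real \<Rightarrow> complex"
  assumes der: "\<And>t. (f has_vector_derivative \<mu> * f t + g t) (at t)"
    and g: "\<And>t. t \<ge> 0 \<Longrightarrow> norm (g t) \<le> K"
    and neg: "Re \<mu> < 0" and t: "t \<ge> 0"
  shows "norm (f t) \<le> norm (f 0) + K / - Re \<mu>"
proof (cases "t = 0")
  case True
  have "K \<ge> 0" using g[of 0] norm_ge_zero order_trans by blast
  then have "K / - Re \<mu> \<ge> 0" using neg by (intro divide_nonneg_pos) auto
  then show ?thesis using True by simp
next
  case False
  define a where "a = - Re \<mu>"
  have a: "a > 0" using neg by (simp add: a_def)
  have K: "K \<ge> 0" using g[of 0] norm_ge_zero order_trans by blast
  define h where "h = (\<lambda>s. exp (- (complex_of_real s * \<mu>)) * f s)"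
  \<comment> \<open>A primitive of the majorant K exp(a s) of the derivative of \<open>h\<close>;
    the mean value inequality then bounds the increment of \<open>h\<close> by that of
    \<open>\<phi>\<close>.\<close>
  define \<phi> where "\<phi> = (\<lambda>s. K / a * exp (a * s))"
  have e: "((\<lambda>s. exp (- (complex_of_real s * \<mu>))) has_vector_derivative
      - \<mu> * exp (- (complex_of_real s * \<mu>))) (at s)" for s
  proof -
    have "((\<lambda>z. exp (- (z * \<mu>))) has_field_derivative - \<mu> * exp (- (of_real s * \<mu>))) (at (of_real s))"
      by (auto intro!: derivative_eq_intros)
    from has_vector_derivative_real_field[OF this] show ?thesis
      by (simp add: o_def)
  qed
  have h': "(h has_vector_derivative exp (- (of_real s * \<mu>)) * g s) (at s)" for s
    unfolding h_def
    by (rule has_vector_derivative_eq_rhs[OF has_vector_derivative_mult[OF e der]])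
      (simp add: algebra_simps)
  have \<phi>': "(\<phi> has_vector_derivative K * exp (a * s)) (at s)" for s
    unfolding \<phi>_def using a
    by (auto intro!: derivative_eq_intros simp flip: has_real_derivative_iff_has_vector_derivative)
  have nexp: "norm (exp (- (complex_of_real s * \<mu>))) = exp (a * s)" for s
    by (simp add: norm_exp_eq_Re a_def algebra_simps)
  have "norm (h t - h 0) \<le> \<phi> t - \<phi> 0"
  proof (rule differentiable_bound_general)
    show "0 < t" using t False by simp
    show "continuous_on {0..t} h" "continuous_on {0..t} \<phi>"
      by (meson h' \<phi>' continuous_at_imp_continuous_on has_vector_derivative_continuous)+
    show "norm (exp (- (of_real s * \<mu>)) * g s) \<le> K * exp (a * s)" if "0 < s" for s
      using g[of s] that mult_right_mono[of "norm (g s)" K "exp (a * s)"]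
      by (simp add: norm_mult a_def algebra_simps)
  qed (rule h' \<phi>')+
  also have "\<dots> \<le> K / a * exp (a * t)"
    using a K by (simp add: \<phi>_def)
  finally have "norm (h t) \<le> norm (f 0) + K / a * exp (a * t)"
    using norm_triangle_ineq2[of "h t" "h 0"] by (simp add: h_def)
  also have "\<dots> \<le> (norm (f 0) + K / a) * exp (a * t)"
    using a t by (simp add: ring_distribs mult_le_cancel_left1)
  also have "norm (h t) = norm (f t) * exp (a * t)"
    by (simp only: h_def norm_mult nexp) (rule mult.commute)
  finally show ?thesis by (simp add: a_def)
qed

section \<open>Polynomials in a matrix acting on vectors\<close>

text \<open>
  \<open>p(A) x\<close>, evaluated by Horner's scheme; multiplication on \<open>'a ^ 'n ^ 'n\<close> is componentwise, so
  \<open>poly\<close> cannot be used.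
\<close>

definition poly_act :: "'a::field poly \<Rightarrow> 'a ^ 'n ^ 'n \<Rightarrow> 'a ^ 'n \<Rightarrow> 'a ^ 'n" where
  "poly_act p A x = fold_coeffs (\<lambda>a v. a *s x + A *v v) p 0"

lemma poly_act_0 [simp]: "poly_act 0 A x = 0"
  by (simp add: poly_act_def)

lemma poly_act_pCons [simp]: "poly_act (pCons a p) A x = a *s x + A *v poly_act p A x"
  by (cases "p = 0 \<and> a = 0") (auto simp: poly_act_def)

lemma poly_act_add: "poly_act (p + q) A x = poly_act p A x + poly_act q A x"
  by (induction p q rule: poly_induct2)
    (simp_all add: matrix_vector_right_distrib vec.scale_left_distrib)

lemma poly_act_smult: "poly_act (smult c p) A x = c *s poly_act p A x"
  by (induction p) (simp_all add: vector_scalar_commute vec.scale_right_distrib)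

lemma poly_act_sum: "poly_act (\<Sum>i\<in>I. p i) A x = (\<Sum>i\<in>I. poly_act (p i) A x)"
  by (induction I rule: infinite_finite_induct) (simp_all add: poly_act_add)

lemma poly_act_diff_right: "poly_act p A (x - y) = poly_act p A x - poly_act p A y"
  by (induction p)
    (simp_all add: matrix_vector_mult_diff_distrib vec.scale_right_diff_distrib)

lemma poly_act_scale_right: "poly_act p A (c *s x) = c *s poly_act p A x"
  by (induction p)
    (simp_all add: vector_scalar_commute vec.scale_right_distrib mult.commute)

lemma poly_act_mult_right: "poly_act p A (A *v x) = A *v poly_act p A x"
  by (induction p)
    (simp_all add: vector_scalar_commute matrix_vector_right_distrib)

text \<open>Polynomials in \<open>A\<close> commute with \<open>A\<close>, so a linear factor can be
  moved onto the vector. This is what lowers the degree in the induction: if \<open>p\<close> kills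
  \<open>x\<close>, the cofactor \<open>q\<close> kills \<open>(A - c) x\<close>.\<close>

lemma poly_act_linear_factor: "poly_act ([:- c, 1:] * q) A x = poly_act q A (A *v x - c *s x)"
proof -
  have "[:- c, 1:] * q = smult (- c) q + pCons 0 q"
    by simp
  then show ?thesis
    by (simp only: poly_act_add poly_act_smult poly_act_pCons poly_act_diff_right
        poly_act_mult_right poly_act_scale_right) simp
qed

text \<open>The index set has one element more than the dimension. Linear dependence is a property
  of sets, so a repeated value in the family \<open>M\<close> is handled separately, by the
  difference of two equal members.\<close>

lemma nontrivial_relation:
  fixes M :: "nat \<Rightarrow> 'a::euclidean_space"
  obtains c where "\<exists>k\<le>DIM('a). c k \<noteq> 0" "(\<Sum>k\<le>DIM('a). c k *\<^sub>R M k) = 0"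
proof (cases "inj_on M {..DIM('a)}")
  case True
  then have "dependent (M ` {..DIM('a)})"
    using independent_bound[of "M ` {..DIM('a)}"] by (auto simp: card_image)
  then obtain u where u: "\<exists>v\<in>M ` {..DIM('a)}. u v \<noteq> 0" "(\<Sum>v\<in>M ` {..DIM('a)}. u v *\<^sub>R v) = 0"
    by (subst (asm) dependent_finite) auto
  then show ?thesis
    using that[of "u \<circ> M"] True by (auto simp: sum.reindex)
next
  case False
  then obtain i j where ij: "i \<le> DIM('a)" "j \<le> DIM('a)" "i \<noteq> j" "M i = M j"
    by (auto simp: inj_on_def)
  define c where "c = (\<lambda>k. if k = i then 1 else if k = j then - 1 else 0 :: real)"
  have "(\<Sum>k\<le>DIM('a). c k *\<^sub>R M k) =
      (\<Sum>k\<le>DIM('a). (if k = i then M i else 0) - (if k = j then M j else 0))"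
    using ij by (intro sum.cong) (auto simp: c_def)
  also have "\<dots> = 0"
    using ij by (simp add: sum_subtractf)
  finally show ?thesis
    using ij by (intro that[of c]) (auto simp: c_def)
qed

text \<open>The matrix space has finite dimension, so the powers of \<open>A\<close> satisfy a
  nontrivial linear relation, whose coefficients are those of \<open>p\<close>.\<close>

lemma annihilating_polynomial:
  fixes A :: "complex ^ 'n ^ 'n"
  obtains p where "p \<noteq> 0" "\<And>x. poly_act p A x = 0"
proof -
  define P where "P k = (((**) A) ^^ k) (mat 1)" for k
  \<comment> \<open>This is the dimension over the reals, so the relation has real coefficients,
    embedded into the complex numbers in \<open>p\<close>.\<close>
  define N where "N = DIM(complex ^ 'n ^ 'n)"
  obtain c where c: "\<exists>k\<le>N. c k \<noteq> 0" "(\<Sum>k\<le>N. c k *\<^sub>R P k) = 0"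
    using nontrivial_relation[of P] unfolding N_def by blast
  define p where "p = (\<Sum>k\<le>N. monom (complex_of_real (c k)) k)"
  have "coeff p k = of_real (c k)" if "k \<le> N" for k
    using that by (simp add: p_def coeff_sum)
  then have "p \<noteq> 0" using c(1) by force
  moreover have "poly_act p A x = 0" for x
  proof -
    have mon: "poly_act (monom (of_real a) k) A x = a *\<^sub>R (P k *v x)" for a k
    proof (induction k)
      case 0
      then show ?case by (simp add: monom_0 P_def vec_eq_iff) (simp add: scaleR_conv_of_real)
    next
      case (Suc k)
      then show ?case
        by (simp add: monom_Suc P_def linear_cmul[OF matrix_vector_mul_linear]
            flip: matrix_vector_mul_assoc)
    qed
    have "(\<Sum>k\<le>N. c k *\<^sub>R (P k *v x)) = (\<Sum>k\<le>N. c k *\<^sub>R P k) *v x"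
      by (simp add: vec_eq_iff matrix_vector_mult_def scaleR_sum_right sum_distrib_right)
        (subst sum.swap, simp)
    then show ?thesis
      by (simp add: p_def poly_act_sum mon c(2))
  qed
  ultimately show thesis by (rule that)
qed

text \<open>An injective square matrix has a left inverse \<open>L\<close>, and the components of
  \<open>x\<close> are fixed linear combinations of those of \<open>M *v x\<close> with the entries
  of \<open>L\<close> as coefficients.\<close>

lemma bounded_left_invertible_mult:
  fixes M :: "complex ^ 'n ^ 'n" and x :: "real \<Rightarrow> complex ^ 'n"
  assumes inj: "\<And>v. M *v v = 0 \<Longrightarrow> v = 0"
    and bdd: "\<And>i. \<exists>K. \<forall>t\<ge>0. norm ((M *v x t) $ i) \<le> K"
  shows "\<exists>K. \<forall>t\<ge>0. norm (x t $ i) \<le> K"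
proof -
  obtain L where L: "L ** M = mat 1"
    using inj matrix_left_invertible_ker[of M] by blast
  obtain K where K: "\<And>j t. t \<ge> 0 \<Longrightarrow> norm ((M *v x t) $ j) \<le> K j"
    using bdd by metis
  have "norm (x t $ i) \<le> (\<Sum>j\<in>UNIV. norm (L $ i $ j) * K j)" if "t \<ge> 0" for t
  proof -
    have "x t = L *v (M *v x t)"
      by (simp add: matrix_vector_mul_assoc L)
    then have "x t $ i = (\<Sum>j\<in>UNIV. L $ i $ j * (M *v x t) $ j)"
      by (metis (no_types) matrix_vector_mult_def vec_lambda_beta)
    then show ?thesis
      using K[OF that] by (auto intro!: sum_norm_le mult_left_mono simp: norm_mult)
  qed
  then show ?thesis by blast
qed

lemma stable_curve_bounded:
  fixes A :: "complex ^ 'n ^ 'n" and x :: "real \<Rightarrow> complex ^ 'n"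
  assumes stable: "\<And>\<mu>. mat_eigenvalue A \<mu> \<Longrightarrow> Re \<mu> < 0"
    and der: "\<And>t i. ((\<lambda>t. x t $ i) has_vector_derivative (A *v x t) $ i) (at t)"
  shows "\<exists>K. \<forall>t\<ge>0. norm (x t $ i) \<le> K"
proof -
  \<comment> \<open>Generalised over polynomial and curve, because the induction step passes from
    \<open>p\<close> to its cofactor \<open>q\<close> and from \<open>x\<close> to
    \<open>y\<close>.\<close>
  have gen: "\<exists>K. \<forall>t\<ge>0. norm (x t $ i) \<le> K"
    if "p \<noteq> 0" "\<And>t. poly_act p A (x t) = 0"
      "\<And>t i. ((\<lambda>t. x t $ i) has_vector_derivative (A *v x t) $ i) (at t)"
    for p i and x :: "real \<Rightarrow> complex ^ 'n"
    using that
  proof (induction "degree p" arbitrary: p x i)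
    case 0
    then obtain c where "p = [:c:]" using degree_eq_zeroE by metis
    then have "x t = 0" for t
      using 0 by (metis poly_act_pCons poly_act_0 matrix_vector_mult_0_right add.right_neutral
          vec.scale_eq_0_iff pCons_0_0)
    then show ?case by auto
  next
    case (Suc n)
    then have "\<not> constant (poly p)" by (simp add: constant_degree)
    then obtain \<mu> where "poly p \<mu> = 0" using fundamental_theorem_of_algebra by blast
    then obtain q where q: "p = [:- \<mu>, 1:] * q" by (auto simp: poly_eq_0_iff_dvd)
    then have "q \<noteq> 0" using Suc.prems(1) by auto
    then have "degree p = Suc (degree q)" unfolding q by (subst degree_mult_eq) auto
    then have dq: "n = degree q" using Suc.hyps(2) by simp
    define y where "y t = A *v x t - \<mu> *s x t" for t
    have y0: "poly_act q A (y t) = 0" for t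
      using Suc.prems(2)[of t] unfolding q poly_act_linear_factor y_def .
    have Ax: "((\<lambda>t. (A *v x t) $ i) has_vector_derivative (A *v (A *v x t)) $ i) (at t)" for t i
    proof -
      have "((\<lambda>t. \<Sum>j\<in>UNIV. A $ i $ j * x t $ j) has_vector_derivative
          (\<Sum>j\<in>UNIV. A $ i $ j * (A *v x t) $ j)) (at t)"
        by (intro has_vector_derivative_sum has_vector_derivative_mult_right Suc.prems(3))
      then show ?thesis by (simp add: matrix_vector_mult_def)
    qed
    \<comment> \<open>\<open>A\<close> commutes with \<open>A - \<mu>\<close>, so \<open>y\<close>
      solves the same differential equation as \<open>x\<close>.\<close>
    have y': "((\<lambda>t. y t $ i) has_vector_derivative (A *v y t) $ i) (at t)" for t i
      unfolding y_def
      by (auto intro!: derivative_eq_intros Ax Suc.prems(3)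
          simp: matrix_vector_mult_diff_distrib vector_scalar_commute)
    have y_bdd: "\<exists>K. \<forall>t\<ge>0. norm (y t $ i) \<le> K" for i
      using Suc.hyps(1)[OF dq \<open>q \<noteq> 0\<close> y0 y'] .
    show ?case
    \<comment> \<open>\<open>p\<close> is merely some annihilating polynomial, so its root may fail
      to be an eigenvalue; then stability gives no sign for \<open>Re \<mu>\<close>, but
      \<open>A - mat \<mu>\<close> is injective.\<close>
    proof (cases "mat_eigenvalue A \<mu>")
      case True
      obtain K where "\<And>t. t \<ge> 0 \<Longrightarrow> norm (y t $ i) \<le> K" using y_bdd by blast
      moreover have "((\<lambda>t. x t $ i) has_vector_derivative \<mu> * x t $ i + y t $ i) (at t)" for t
        using Suc.prems(3)[of i t] by (simp add: y_def)
      ultimately show ?thesis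
        using scalar_stable_ode_bounded[of "\<lambda>t. x t $ i" \<mu> "\<lambda>t. y t $ i" K] stable[OF True] by blast
    next
      case False
      have shift: "(A - mat \<mu>) *v v = A *v v - \<mu> *s v" for v
        by (simp add: matrix_vector_mult_diff_rdistrib)
          (simp add: vec_eq_iff matrix_vector_mult_def mat_def mult_delta_left)
      show ?thesis
      proof (rule bounded_left_invertible_mult)
        show "v = 0" if "(A - mat \<mu>) *v v = 0" for v
          using that False unfolding shift mat_eigenvalue_def by (metis eq_iff_diff_eq_0)
        show "\<exists>K. \<forall>t\<ge>0. norm (((A - mat \<mu>) *v x t) $ j) \<le> K" for j
          using y_bdd[of j] unfolding shift y_def .
      qed
    qed
  qed
  obtain p where "p \<noteq> 0" "\<And>v. poly_act p A v = 0"
    using annihilating_polynomial[of A] by blast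
  then show ?thesis using der by (rule gen)
qed

subsection \<open>The matrix exponential\<close>

text \<open>Left multiplication by \<open>A\<close> is a bounded linear map, iterated
  \<open>k\<close> times. The factor \<open>norm (mat 1)\<close> stays because the norm is the
  Frobenius norm, for which the identity matrix need not have norm 1.\<close>

lemma norm_mat_pow_le: "\<exists>K>0. \<forall>k. norm (mat_pow A k) \<le> K ^ k * norm (mat 1 :: real ^ 'n ^ 'n)"
  for A :: "real ^ 'n ^ 'n"
proof -
  have "linear ((**) A :: real ^ 'n ^ 'n \<Rightarrow> real ^ 'n ^ 'n)"
    by (intro linearI) (simp_all add: matrix_add_ldistrib scalar_matrix_assoc matrix_scalar_ac)
  then obtain K where K: "K > 0" "\<And>X :: real ^ 'n ^ 'n. norm (A ** X) \<le> K * norm X"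
    using linear_bounded_pos by blast
  have "norm (mat_pow A k) \<le> K ^ k * norm (mat 1 :: real ^ 'n ^ 'n)" for k
  proof (induction k)
    case (Suc k)
    have "norm (mat_pow A (Suc k)) \<le> K * norm (mat_pow A k)"
      by (simp add: mat_pow_def K(2))
    also have "\<dots> \<le> K * (K ^ k * norm (mat 1 :: real ^ 'n ^ 'n))"
      using Suc K(1) by (intro mult_left_mono) auto
    finally show ?case by (simp add: mult.assoc)
  qed (simp add: mat_pow_def)
  then show ?thesis using K(1) by blast
qed

lemma mat_pow_scaleR: "mat_pow (t *\<^sub>R A) k = t ^ k *\<^sub>R mat_pow A k"
  by (induction k) (simp_all add: mat_pow_def matrix_scalar_ac flip: scalar_matrix_assoc)

lemma summable_mat_exp: "summable (\<lambda>k. mat_pow A k /\<^sub>R fact k)"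
  for A :: "real ^ 'n ^ 'n"
proof -
  obtain K where K: "\<And>k. norm (mat_pow A k) \<le> K ^ k * norm (mat 1 :: real ^ 'n ^ 'n)"
    using norm_mat_pow_le[of A] by blast
  have "summable (\<lambda>k. (K ^ k /\<^sub>R fact k) * norm (mat 1 :: real ^ 'n ^ 'n))"
    by (intro summable_mult2 summable_exp_generic)
  then show ?thesis
    by (rule summable_comparison_test'[where N = 0])
      (use K in \<open>simp add: divide_simps mult.commute\<close>)
qed

text \<open>Each entry of exp(tA) is a scalar power series in \<open>t\<close>, which makes termwise
  differentiation of real power series applicable.\<close>

lemma mat_exp_component:
  "(\<lambda>k. mat_pow A k $ i $ j / fact k * t ^ k) sums (mat_exp (t *\<^sub>R A) $ i $ j)"
proof -
  have "(\<lambda>k. mat_pow (t *\<^sub>R A) k /\<^sub>R fact k) sums mat_exp (t *\<^sub>R A)"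
    unfolding mat_exp_def by (rule summable_sums[OF summable_mat_exp])
  then have "(\<lambda>k. (mat_pow (t *\<^sub>R A) k /\<^sub>R fact k) $ i $ j) sums (mat_exp (t *\<^sub>R A) $ i $ j)"
    by (intro bounded_linear.sums[OF bounded_linear_vec_nth])
  then show ?thesis
    by (simp add: mat_pow_scaleR divide_inverse mult_ac)
qed

lemma has_real_derivative_mat_exp:
  "((\<lambda>t. mat_exp (t *\<^sub>R A) $ i $ j) has_real_derivative
     (A ** mat_exp (t *\<^sub>R A)) $ i $ j) (at t)"
proof -
  define c where "c k = mat_pow A k $ i $ j / fact k" for k
  have "((\<lambda>t. \<Sum>k. c k * t ^ k) has_real_derivative (\<Sum>k. diffs c k * t ^ k)) (at t)"
    using mat_exp_component[of A i j]
    by (intro termdiffs_strong_converges_everywhere) (auto simp: c_def sums_iff)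
  moreover have "(\<lambda>t. \<Sum>k. c k * t ^ k) = (\<lambda>t. mat_exp (t *\<^sub>R A) $ i $ j)"
    using mat_exp_component[of A i j] by (auto simp: c_def sums_iff)
  moreover have "(\<lambda>k. diffs c k * t ^ k) sums ((A ** mat_exp (t *\<^sub>R A)) $ i $ j)"
  proof -
    have "(\<lambda>k. \<Sum>l\<in>UNIV. A $ i $ l * (mat_pow A k $ l $ j / fact k * t ^ k)) sums
        (\<Sum>l\<in>UNIV. A $ i $ l * mat_exp (t *\<^sub>R A) $ l $ j)"
      by (intro sums_sum sums_mult mat_exp_component)
    moreover have "(\<Sum>l\<in>UNIV. A $ i $ l * (mat_pow A k $ l $ j / fact k * t ^ k)) = diffs c k * t ^ k" for k
    proof -
      \<comment> \<open>The factor k + 1 from differentiation turns 1 / (k + 1)! into 1 / k!,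
        leaving an entry of the next power of \<open>A\<close>.\<close>
      have "diffs c k = mat_pow A (Suc k) $ i $ j / fact k"
        by (simp add: diffs_def c_def del: of_nat_Suc)
      then show ?thesis
        by (simp add: mat_pow_def matrix_matrix_mult_def sum_divide_distrib sum_distrib_left mult_ac)
    qed
    ultimately show ?thesis
      by (simp add: matrix_matrix_mult_def)
  qed
  ultimately show ?thesis by (simp add: sums_iff)
qed

lemma continuous_on_mat_exp: "continuous_on S (\<lambda>t. mat_exp (t *\<^sub>R A))"
proof -
  have "continuous_on S (\<lambda>t. \<chi> i j. mat_exp (t *\<^sub>R A) $ i $ j)"
    by (intro continuous_on_vec_lambda continuous_at_imp_continuous_on ballI
        DERIV_isCont[OF has_real_derivative_mat_exp])
  then show ?thesis by simp
qed

text \<open>Each column of exp(tA), viewed over the complex numbers, is a curve with x' = A x, so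
  every entry is bounded; the norm is at most the sum of the entry bounds.\<close>

lemma stable_mat_exp_bounded:
  fixes A :: "real ^ 'n ^ 'n"
  assumes "stable_matrix A"
  shows "\<exists>K. \<forall>t\<ge>0. norm (mat_exp (t *\<^sub>R A)) \<le> K"
proof -
  define Ac :: "complex ^ 'n ^ 'n" where "Ac = (\<chi> i j. of_real (A $ i $ j))"
  have "\<exists>K. \<forall>t\<ge>0. \<bar>mat_exp (t *\<^sub>R A) $ i $ j\<bar> \<le> K" for i j
  proof -
    define x :: "real \<Rightarrow> complex ^ 'n" where "x t = (\<chi> i. of_real (mat_exp (t *\<^sub>R A) $ i $ j))" for t
    have "\<exists>K. \<forall>t\<ge>0. norm (x t $ i) \<le> K"
    proof (rule stable_curve_bounded)
      show "Re \<mu> < 0" if "mat_eigenvalue Ac \<mu>" for \<mu>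
        using assms that by (simp add: stable_matrix_def Ac_def)
      show "((\<lambda>t. x t $ i) has_vector_derivative (Ac *v x t) $ i) (at t)" for t i
        using has_vector_derivative_of_real[OF has_real_derivative_mat_exp[of A i j t]]
        by (simp add: x_def Ac_def matrix_vector_mult_def matrix_matrix_mult_def)
    qed
    then show ?thesis by (simp add: x_def)
  qed
  then obtain K where K: "\<And>i j t. t \<ge> 0 \<Longrightarrow> \<bar>mat_exp (t *\<^sub>R A) $ i $ j\<bar> \<le> K i j"
    by metis
  have "norm (mat_exp (t *\<^sub>R A)) \<le> (\<Sum>i\<in>UNIV. \<Sum>j\<in>UNIV. K i j)" if "t \<ge> 0" for t
  proof -
    have "norm (mat_exp (t *\<^sub>R A)) \<le> (\<Sum>i\<in>UNIV. norm (mat_exp (t *\<^sub>R A) $ i))"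
      by (simp add: norm_vec_def L2_set_le_sum)
    also have "\<dots> \<le> (\<Sum>i\<in>UNIV. \<Sum>j\<in>UNIV. K i j)"
      using K[OF that] by (intro sum_mono order_trans[OF norm_le_l1_cart] sum_mono) auto
    finally show ?thesis .
  qed
  then show ?thesis by blast
qed

section \<open>Boundedness and continuity of the impulse response\<close>

lemma matrix_add_rdistrib: "(A + B) ** C = A ** C + B ** C"
  by (simp add: vec_eq_iff matrix_matrix_mult_def distrib_right sum.distrib)

lemma bounded_linear_matrix_sandwich: "bounded_linear (\<lambda>X. C ** X ** B)"
  for B :: "real ^ 'p ^ 'n" and C :: "real ^ 'n ^ 'm"
  by (intro linear_linear[THEN iffD2] linearI)
    (simp_all add: matrix_add_ldistrib matrix_add_rdistrib matrix_scalar_ac flip: scalar_matrix_assoc)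

lemma stable_impulse_response_bounded:
  assumes "stable_matrix A"
  shows "\<exists>K. \<forall>t\<ge>0. norm (impulse_response A B C t) \<le> K"
proof -
  obtain K where K: "\<And>t. t \<ge> 0 \<Longrightarrow> norm (mat_exp (t *\<^sub>R A)) \<le> K"
    using stable_mat_exp_bounded[OF assms] by blast
  obtain L where L: "L > 0" "\<And>X. norm (C ** X ** B) \<le> norm X * L"
    using bounded_linear.pos_bounded[OF bounded_linear_matrix_sandwich[of C B]] by blast
  have "norm (impulse_response A B C t) \<le> K * L" if "t \<ge> 0" for t
    unfolding impulse_response_def
    using L(2) by (rule order_trans) (use K[OF that] L(1) in \<open>simp add: mult_right_mono\<close>)
  then show ?thesis by blast
qed

lemma continuous_on_impulse_response: "continuous_on S (impulse_response A B C)"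
  unfolding impulse_response_def[abs_def]
  by (intro bounded_linear.continuous_on[OF bounded_linear_matrix_sandwich] continuous_on_mat_exp)

subsection \<open>The largest singular value\<close>

text \<open>If \<open>T v\<close> were nonzero, a small step from \<open>v\<close> in the direction
  \<open>- T v\<close> would make the quadratic form negative, as the first-order term
  dominates.\<close>

lemma psd_quadratic_kernel:
  fixes T :: "'a::real_inner \<Rightarrow> 'a"
  assumes lin: "linear T" and sym: "\<And>x y. x \<bullet> T y = T x \<bullet> y"
    and psd: "\<And>x. x \<bullet> T x \<ge> 0" and v: "v \<bullet> T v = 0"
  shows "T v = 0"
proof (rule ccontr)
  assume nz: "T v \<noteq> 0"
  define w where "w = T v"
  define a where "a = w \<bullet> w"
  define b where "b = w \<bullet> T w"
  have a: "a > 0" and b: "b \<ge> 0" using nz psd by (auto simp: w_def a_def b_def)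
  \<comment> \<open>Along the step the form equals - 2 s a + s^2 b. This choice gives s b \<le> a,
    hence a value of at most - s a; the summand 1 keeps the denominator positive when
    \<open>b = 0\<close>.\<close>
  define s where "s = a / (b + 1)"
  have "v \<bullet> T w = a" by (simp add: sym a_def w_def)
  then have "(v - s *\<^sub>R w) \<bullet> T (v - s *\<^sub>R w) = - 2 * s * a + s\<^sup>2 * b"
    using v by (simp add: linear_diff[OF lin] linear_cmul[OF lin] inner_diff_left inner_diff_right
        a_def b_def w_def[symmetric] power2_eq_square algebra_simps)
  moreover have "s * b \<le> a" using a b by (simp add: s_def field_simps)
  then have "s * (s * b) \<le> s * a" using a b by (intro mult_left_mono) (auto simp: s_def)
  moreover have "s * a > 0" using a b by (simp add: s_def)
  ultimately have "(v - s *\<^sub>R w) \<bullet> T (v - s *\<^sub>R w) < 0"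
    by (simp add: power2_eq_square mult.assoc)
  then show False using psd not_less by blast
qed

section \<open>Eigenvalues of the Gram matrix and the operator norm\<close>

lemma inner_gram_matrix: "x \<bullet> ((transpose M ** M) *v y) = (M *v x) \<bullet> (M *v y)"
  for M :: "real ^ 'p ^ 'm"
proof -
  have "(transpose M ** M) *v y = transpose M *v (M *v y)"
    by (simp only: matrix_vector_mul_assoc)
  then show ?thesis
    by (metis dot_lmul_matrix inner_commute transpose_matrix_vector)
qed

lemma gram_matrix_eigenvalue:
  fixes M :: "real ^ 'p ^ 'm"
  assumes "(transpose M ** M) *v v = \<mu> *s v"
  shows "(norm (M *v v))\<^sup>2 = \<mu> * (norm v)\<^sup>2"
  using inner_gram_matrix[of v M v] assms
  by (simp add: scalar_mult_eq_scaleR power2_norm_eq_inner)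

text \<open>Eigenvectors of a symmetric matrix for distinct eigenvalues are orthogonal, hence
  independent, and finite dimension limits their number. Finiteness gives the \<open>Max\<close> in
  \<open>max_singular_value\<close> its intended meaning.\<close>

lemma finite_gram_eigenvalues: "finite {\<mu>. mat_eigenvalue (transpose M ** M) \<mu>}"
  for M :: "real ^ 'p ^ 'm"
proof -
  define E where "E = {\<mu>. mat_eigenvalue (transpose M ** M) \<mu>}"
  have "\<forall>\<mu>\<in>E. \<exists>v. v \<noteq> 0 \<and> (transpose M ** M) *v v = \<mu> *s v"
    by (simp add: E_def mat_eigenvalue_def)
  then obtain e where e: "\<And>\<mu>. \<mu> \<in> E \<Longrightarrow> e \<mu> \<noteq> 0"
      "\<And>\<mu>. \<mu> \<in> E \<Longrightarrow> (transpose M ** M) *v e \<mu> = \<mu> *s e \<mu>"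
    by metis
  have orth: "e \<mu> \<bullet> e \<nu> = 0" if "\<mu> \<in> E" "\<nu> \<in> E" "\<mu> \<noteq> \<nu>" for \<mu> \<nu>
  proof -
    \<comment> \<open>Both sides equal the inner product of \<open>M *v e \<mu>\<close> and
      \<open>M *v e \<nu>\<close>.\<close>
    have "\<nu> * (e \<mu> \<bullet> e \<nu>) = \<mu> * (e \<mu> \<bullet> e \<nu>)"
      using inner_gram_matrix[of "e \<mu>" M "e \<nu>"] inner_gram_matrix[of "e \<nu>" M "e \<mu>"] e(2) that
      by (simp add: scalar_mult_eq_scaleR inner_commute)
    then show ?thesis using that(3) by simp
  qed
  have "independent (e ` E)"
    using e(1) orth by (intro pairwise_orthogonal_independent) (auto simp: pairwise_def orthogonal_def)
  then have "finite (e ` E)" using independent_bound by blast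
  moreover have "inj_on e E"
    using orth e(1) by (metis inj_onI inner_eq_zero_iff)
  ultimately show ?thesis unfolding E_def by (rule finite_imageD)
qed

text \<open>Let \<open>v\<close> maximise the norm of \<open>M *v v\<close> on the compact unit
  sphere, with maximum \<open>\<sigma>\<close>. The form of \<sigma>^2 I - M^T M is nonnegative and
  vanishes at \<open>v\<close>, so \<open>v\<close> is an eigenvector of M^T M for \<sigma>^2. Any
  other eigenvalue is at most \<sigma>^2, by the bound applied to its eigenvector.\<close>

lemma max_singular_value_attained:
  fixes M :: "real ^ 'p ^ 'm"
  obtains v where "norm v = 1" "norm (M *v v) = max_singular_value M"
    "\<And>x. norm (M *v x) \<le> max_singular_value M * norm x"
proof -
  define S :: "(real ^ 'p) set" where "S = sphere 0 1"
  obtain v where v: "v \<in> S" "\<And>x. x \<in> S \<Longrightarrow> norm (M *v x) \<le> norm (M *v v)"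
  proof -
    have "compact S" "S \<noteq> {}" by (simp_all add: S_def)
    then show thesis
      using that continuous_attains_sup[of S "\<lambda>x. norm (M *v x)"]
      by (metis continuous_on_norm matrix_vector_mult_linear_continuous_on)
  qed
  define \<sigma> where "\<sigma> = norm (M *v v)"
  have nv: "norm v = 1" using v(1) by (simp add: S_def)
  have bound: "norm (M *v x) \<le> \<sigma> * norm x" for x
  proof (cases "x = 0")
    case False
    then have "norm (M *v (x /\<^sub>R norm x)) \<le> \<sigma>"
      using v(2)[of "x /\<^sub>R norm x"] by (simp add: S_def \<sigma>_def)
    then show ?thesis
      using False by (simp add: matrix_vector_mult_scaleR divide_simps mult.commute)
  qed simp
  define T where "T x = \<sigma>\<^sup>2 *\<^sub>R x - (transpose M ** M) *v x" for x
  have "T v = 0"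
  proof (rule psd_quadratic_kernel[of T])
    show "linear T"
      by (rule linearI)
        (simp_all add: T_def algebra_simps matrix_vector_right_distrib matrix_vector_mult_scaleR)
    show "x \<bullet> T y = T x \<bullet> y" for x y
      using inner_gram_matrix[of x M y] inner_gram_matrix[of y M x]
      by (simp add: T_def inner_diff_left inner_diff_right inner_commute)
    show "x \<bullet> T x \<ge> 0" for x
      using power_mono[OF bound[of x], of 2] inner_gram_matrix[of x M x]
      by (simp add: T_def inner_diff_right power_mult_distrib flip: power2_norm_eq_inner)
    show "v \<bullet> T v = 0"
      using inner_gram_matrix[of v M v] nv
      by (simp add: T_def inner_diff_right \<sigma>_def flip: power2_norm_eq_inner)
  qed
  then have "mat_eigenvalue (transpose M ** M) (\<sigma>\<^sup>2)"
    unfolding mat_eigenvalue_def using nv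
    by (intro exI[of _ v]) (auto simp: T_def scalar_mult_eq_scaleR)
  then have "\<sigma> \<in> singular_values M"
    unfolding singular_values_def using \<sigma>_def by force
  moreover have "finite (singular_values M)"
    using finite_imageI[OF finite_gram_eigenvalues[of M], of sqrt]
    by (simp add: singular_values_def setcompr_eq_image)
  moreover have "s \<le> \<sigma>" if s: "s \<in> singular_values M" for s
  proof -
    obtain \<mu> u where \<mu>: "s = sqrt \<mu>" "u \<noteq> 0" "(transpose M ** M) *v u = \<mu> *s u"
      using s unfolding singular_values_def mat_eigenvalue_def by blast
    have "\<mu> * (norm u)\<^sup>2 \<le> \<sigma>\<^sup>2 * (norm u)\<^sup>2"
      using gram_matrix_eigenvalue[OF \<mu>(3)] power_mono[OF bound[of u], of 2]
      by (simp add: power_mult_distrib)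
    then have "\<mu> \<le> \<sigma>\<^sup>2" using \<mu>(2) by simp
    then show ?thesis unfolding \<mu>(1) by (metis \<sigma>_def norm_ge_zero real_le_lsqrt real_sqrt_le_mono real_sqrt_pow2_iff real_sqrt_abs abs_norm_cancel)
  qed
  ultimately have "max_singular_value M = \<sigma>"
    unfolding max_singular_value_def by (intro Max_eqI)
  with nv bound show thesis by (intro that[of v]) (simp_all add: \<sigma>_def)
qed

lemma bounded_bilinear_matrix_vector_mult:
  "bounded_bilinear ((*v) :: real ^ 'p ^ 'm \<Rightarrow> real ^ 'p \<Rightarrow> real ^ 'm)"
proof -
  have "bilinear ((*v) :: real ^ 'p ^ 'm \<Rightarrow> real ^ 'p \<Rightarrow> real ^ 'm)"
    unfolding bilinear_def
    by (auto intro!: linearI simp: matrix_vector_right_distrib matrix_vector_mult_add_rdistrib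
        matrix_vector_mult_scaleR scaleR_matrix_vector_assoc)
  then show ?thesis by (simp add: bilinear_conv_bounded_bilinear)
qed

text \<open>Boundedness of the bilinear product gives a constant independent of \<open>M\<close>; it
  is applied at a unit vector where the singular value is attained. This turns a norm bound on
  \<open>G\<close> into finiteness of \<open>M0 G\<close>.\<close>

lemma max_singular_value_le_norm:
  "\<exists>L. \<forall>M :: real ^ 'p ^ 'm. max_singular_value M \<le> L * norm M"
proof -
  obtain L where L: "\<And>(M :: real ^ 'p ^ 'm) x. norm (M *v x) \<le> norm M * norm x * L"
    using bounded_bilinear.bounded[OF bounded_bilinear_matrix_vector_mult] by blast
  have "max_singular_value M \<le> L * norm M" for M :: "real ^ 'p ^ 'm"
    by (rule max_singular_value_attained[of M]) (metis L mult.commute mult.right_neutral)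
  then show ?thesis by blast
qed

subsection \<open>The induced norm\<close>

lemma norm_12_nonneg: "norm_12 w \<ge> 0"
  unfolding norm_12_def set_lebesgue_integral_def by (intro integral_nonneg_AE) auto

text \<open>A nonnegative integrable function with integral 0 vanishes almost everywhere. Positivity
  makes the division by \<open>norm_12 w\<close> in the induced norm legitimate.\<close>

lemma norm_12_pos:
  assumes "w \<in> L1_signals" "nonzero_signal w"
  shows "norm_12 w > 0"
proof -
  have int: "integrable lebesgue (\<lambda>t. indicator {0..} t * norm (w t))"
    using set_integrable_norm[of lebesgue "{0..}" w] assms(1)
    by (simp add: L1_signals_def set_integrable_def)
  have "norm_12 w \<noteq> 0"
  proof
    assume "norm_12 w = 0"
    then have "AE t in lebesgue. indicator {0..} t * norm (w t) = 0"
      using integral_nonneg_eq_0_iff_AE[OF int] by (simp add: norm_12_def set_lebesgue_integral_def)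
    then have "AE t in lebesgue. t \<in> {0..} \<longrightarrow> w t = 0"
      by (rule eventually_mono) (auto split: split_indicator_asm)
    then show False using assms(2) by (simp add: nonzero_signal_def)
  qed
  then show ?thesis using norm_12_nonneg[of w] by simp
qed

lemma nonzero_signal_of_norm_12: "norm_12 w \<noteq> 0 \<Longrightarrow> nonzero_signal w"
  unfolding nonzero_signal_def norm_12_def set_lebesgue_integral_def
  by (erule contrapos_nn, rule integral_eq_zero_AE) (auto elim!: eventually_mono split: split_indicator)

text \<open>The norm moves inside the integral, the operator norm bounds the integrand by m |w(s)|,
  and the range is enlarged from [0, t] to the half-line.\<close>

lemma norm_system_output_le:
  assumes w: "w \<in> L1_signals" and G: "\<And>s. s \<ge> 0 \<Longrightarrow> max_singular_value (G s) \<le> m"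
  shows "norm (system_output G w t) \<le> m * norm_12 w"
proof -
  have m: "m \<ge> 0"
    by (rule max_singular_value_attained[of "G 0"]) (metis G norm_ge_zero order_refl order_trans)
  have int: "integrable lebesgue (\<lambda>s. m * (indicator {0..} s * norm (w s)))"
    using set_integrable_norm[of lebesgue "{0..}" w] w
    by (simp add: L1_signals_def set_integrable_def)
  have le: "norm (indicator {0..t} s *\<^sub>R (G (t - s) *v w s)) \<le> m * (indicator {0..} s * norm (w s))" for s
  proof (cases "s \<in> {0..t}")
    case True
    have "norm (G (t - s) *v w s) \<le> max_singular_value (G (t - s)) * norm (w s)"
      by (rule max_singular_value_attained)
    also have "\<dots> \<le> m * norm (w s)"
      using True by (intro mult_right_mono G) auto
    finally show ?thesis using True by simp
  qed (use m in simp)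
  have "norm (system_output G w t) \<le> (LINT s|lebesgue. norm (indicator {0..t} s *\<^sub>R (G (t - s) *v w s)))"
    unfolding system_output_def set_lebesgue_integral_def by (rule integral_norm_bound)
  also have "\<dots> \<le> (LINT s|lebesgue. m * (indicator {0..} s * norm (w s)))"
    \<comment> \<open>The comparison asks for integrability and nonnegativity of the majorant; a
      non-integrable integrand on the left would have integral 0 by convention.\<close>
    using le int m by (intro integral_mono') auto
  also have "\<dots> = m * norm_12 w"
    by (simp add: norm_12_def set_lebesgue_integral_def)
  finally show ?thesis .
qed

text \<open>Evaluating at \<open>T = t + h\<close> places the whole pulse inside the convolution
  interval, and the arguments t + h - s run through [t, t + h], where \<open>G\<close> is defined by
  continuity and close to \<open>G t\<close> on \<open>v\<close>.\<close>

lemma approximate_impulse: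
  fixes G :: "real \<Rightarrow> real ^ 'p ^ 'm"
  assumes G: "continuous_on {0..} G" and t: "t \<ge> 0" and v: "norm v = 1" and e: "e > 0"
  obtains w T where "w \<in> L1_signals" "norm_12 w = 1" "T \<ge> 0"
    "norm (system_output G w T - G t *v v) \<le> e"
proof -
  have "continuous_on {0..} (\<lambda>s. G s *v v)"
    by (intro bounded_bilinear.continuous_on[OF bounded_bilinear_matrix_vector_mult] G continuous_intros)
  then obtain d where d: "d > 0" "\<And>s. s \<ge> 0 \<Longrightarrow> dist s t < d \<Longrightarrow> dist (G s *v v) (G t *v v) < e"
    using t e unfolding continuous_on_iff by (metis atLeast_iff)
  \<comment> \<open>Half of \<open>d\<close> keeps the closed interval [t, t + h] strictly within
    distance \<open>d\<close> of \<open>t\<close>.\<close>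
  define h where "h = d / 2"
  have h: "h > 0" "h < d" using d(1) by (auto simp: h_def)
  define w :: "real \<Rightarrow> real ^ 'p" where "w s = indicator {0..h} s *\<^sub>R (v /\<^sub>R h)" for s
  have meas: "{0..h} \<in> sets lebesgue" "emeasure lebesgue {0..h} < \<infinity>"
    using h by auto
  have ind: "indicator {0..} s *\<^sub>R w s = indicator {0..h} s *\<^sub>R (v /\<^sub>R h)" for s
    by (auto simp: w_def split: split_indicator)
  have "integrable lebesgue (\<lambda>s. indicator {0..h} s *\<^sub>R (v /\<^sub>R h))"
    using meas by (intro integrable_scaleR_left integrable_real_indicator)
  then have L1: "w \<in> L1_signals"
    by (simp add: L1_signals_def set_integrable_def ind)
  have "norm_12 w = (LINT s|lebesgue. indicator {0..h} s * (1 / h))"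
    unfolding norm_12_def set_lebesgue_integral_def
    using h v by (intro Bochner_Integration.integral_cong) (auto simp: w_def divide_inverse split: split_indicator)
  also have "\<dots> = 1"
    using h by simp
  finally have n1: "norm_12 w = 1" .
  have cont: "continuous_on {0..h} (\<lambda>s. G (t + h - s) *v (v /\<^sub>R h))"
    using t by (intro bounded_bilinear.continuous_on[OF bounded_bilinear_matrix_vector_mult]
        continuous_on_compose2[OF G] continuous_intros) auto
  have out: "system_output G w (t + h) = (LINT s:{0..h}|lebesgue. G (t + h - s) *v (v /\<^sub>R h))"
    unfolding system_output_def set_lebesgue_integral_def
    using t by (intro Bochner_Integration.integral_cong) (auto simp: w_def split: split_indicator)
  \<comment> \<open>The target is written as an integral over the same interval, so the error is the
    integral of a difference of norm at most e / h over length h.\<close>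
  have "((\<lambda>s. G t *v (v /\<^sub>R h)) has_integral G t *v v) {0..h}"
    using has_integral_const_real[of "G t *v (v /\<^sub>R h)" 0 h] h
    by (simp add: matrix_vector_mult_scaleR)
  moreover have "((\<lambda>s. G (t + h - s) *v (v /\<^sub>R h)) has_integral system_output G w (t + h)) {0..h}"
    unfolding out
    using absolutely_integrable_continuous_real[OF cont] has_integral_set_lebesgue by blast
  ultimately have "((\<lambda>s. G (t + h - s) *v (v /\<^sub>R h) - G t *v (v /\<^sub>R h)) has_integral
      system_output G w (t + h) - G t *v v) (cbox 0 h)"
    by (auto intro: has_integral_diff)
  then have "norm (system_output G w (t + h) - G t *v v) \<le> e / h * measure lborel (cbox 0 h)"
  proof (rule has_integral_bound[rotated])
    show "norm (G (t + h - s) *v (v /\<^sub>R h) - G t *v (v /\<^sub>R h)) \<le> e / h" if "s \<in> cbox 0 h" for s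
    proof -
      have "norm (G (t + h - s) *v v - G t *v v) < e"
        using d(2)[of "t + h - s"] t h that by (simp add: dist_norm)
      then show ?thesis
        using h by (simp add: matrix_vector_mult_scaleR divide_simps flip: scaleR_diff_right)
    qed
  qed (use e h in simp)
  then have "norm (system_output G w (t + h) - G t *v v) \<le> e"
    using h by simp
  then show thesis
    using that[OF L1 n1, of "t + h"] t h by simp
qed

text \<open>The equalities follow from a cycle of inequalities: unit signals are among the nonzero
  ones, the convolution estimate bounds every quotient by \<open>M0 G\<close>, and approximate
  impulses bring unit signals arbitrarily close to each singular value.\<close>

lemma M0_induced_norm:
  fixes G :: "real \<Rightarrow> real ^ 'p ^ 'm"
  assumes cont: "continuous_on {0..} G" and bdd: "\<And>t. t \<ge> 0 \<Longrightarrow> norm (G t) \<le> K"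
  shows "M0 G < \<infinity>"
    and "M0 G = (SUP w\<in>{w \<in> L1_signals. norm_12 w = 1}. norm_inf2 (system_output G w))"
      (is "_ = ?S1")
    and "M0 G = (SUP w\<in>{w \<in> L1_signals. nonzero_signal w}.
              norm_inf2 (system_output G w) / ereal (norm_12 w))" (is "_ = ?S2")
proof -
  obtain L where L: "\<And>M :: real ^ 'p ^ 'm. max_singular_value M \<le> L * norm M"
    using max_singular_value_le_norm by blast
  have "max_singular_value (G t) \<le> \<bar>L\<bar> * K" if "t \<ge> 0" for t
    using L[of "G t"] mult_mono[of L "\<bar>L\<bar>" "norm (G t)" K] bdd[OF that] by force
  then have "M0 G \<le> ereal (\<bar>L\<bar> * K)"
    unfolding M0_def by (intro SUP_least) auto
  then show fin: "M0 G < \<infinity>" by (rule le_less_trans) simp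
  have "ereal (max_singular_value (G 0)) \<le> M0 G"
    unfolding M0_def by (intro SUP_upper) auto
  \<comment> \<open>A real lower bound excludes minus infinity, so \<open>M0 G\<close> is real and
    the real-valued convolution estimate applies with \<open>m\<close>.\<close>
  with fin obtain m where m: "M0 G = ereal m" by (cases "M0 G") auto
  have Gm: "max_singular_value (G t) \<le> m" if "t \<ge> 0" for t
  proof -
    have "ereal (max_singular_value (G t)) \<le> M0 G"
      unfolding M0_def using that by (intro SUP_upper) auto
    then show ?thesis by (simp add: m)
  qed
  have "?S1 \<le> ?S2"
  proof (rule SUP_mono)
    fix w :: "real \<Rightarrow> real ^ 'p"
    assume w: "w \<in> {w \<in> L1_signals. norm_12 w = 1}"
    then have "w \<in> {w \<in> L1_signals. nonzero_signal w}" using nonzero_signal_of_norm_12[of w] by simp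
    moreover have "norm_inf2 (system_output G w) \<le> norm_inf2 (system_output G w) / ereal (norm_12 w)"
      using w by (simp flip: one_ereal_def)
    ultimately show "\<exists>u\<in>{w \<in> L1_signals. nonzero_signal w}.
        norm_inf2 (system_output G w) \<le> norm_inf2 (system_output G u) / ereal (norm_12 u)"
      by blast
  qed
  moreover have "?S2 \<le> M0 G"
  proof (rule SUP_least)
    fix w :: "real \<Rightarrow> real ^ 'p"
    assume w: "w \<in> {w \<in> L1_signals. nonzero_signal w}"
    then have pos: "norm_12 w > 0" using norm_12_pos by blast
    have "norm_inf2 (system_output G w) \<le> ereal (m * norm_12 w)"
      unfolding norm_inf2_def using w by (intro SUP_least) (simp add: norm_system_output_le Gm)
    then show "norm_inf2 (system_output G w) / ereal (norm_12 w) \<le> M0 G"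
      using pos by (simp add: m ereal_divide_le_pos mult.commute)
  qed
  moreover have "M0 G \<le> ?S1"
    unfolding M0_def
  proof (rule SUP_least)
    fix t :: real assume "t \<in> {0..}"
    then have t: "t \<ge> 0" by simp
    obtain v where v: "norm v = 1" "norm (G t *v v) = max_singular_value (G t)"
      by (rule max_singular_value_attained)
    show "ereal (max_singular_value (G t)) \<le> ?S1"
    proof (rule ereal_le_epsilon2)
      fix e :: real assume "e > 0"
      then obtain w T where w: "w \<in> L1_signals" "norm_12 w = 1" "T \<ge> 0"
          "norm (system_output G w T - G t *v v) \<le> e"
        using approximate_impulse[OF cont t v(1)] by blast
      have "max_singular_value (G t) \<le> norm (system_output G w T) + e"
        using norm_triangle_ineq2[of "G t *v v" "system_output G w T"] w(4) v(2)
        by (simp add: norm_minus_commute)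
      then have "ereal (max_singular_value (G t)) \<le> ereal (norm (system_output G w T)) + ereal e"
        by simp
      also have "ereal (norm (system_output G w T)) \<le> norm_inf2 (system_output G w)"
        unfolding norm_inf2_def using w(3) by (intro SUP_upper) auto
      also have "norm_inf2 (system_output G w) \<le> ?S1"
        using w by (intro SUP_upper) auto
      finally show "ereal (max_singular_value (G t)) \<le> ?S1 + ereal e"
        by (simp add: add_right_mono)
    qed
  qed
  ultimately show "M0 G = ?S1" "M0 G = ?S2" by (auto intro: antisym order_trans)
qed

theorem proposition1:
  fixes A :: "real ^ 'n ^ 'n" and B :: "real ^ 'p ^ 'n" and C :: "real ^ 'n ^ 'm"
    and G :: "real \<Rightarrow> real ^ 'p ^ 'm"
  assumes "stable_matrix A"
    and "G = impulse_response A B C"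
  shows "M0 G < \<infinity> \<and>
    M0 G = (SUP w\<in>{w \<in> L1_signals. norm_12 w = 1}. norm_inf2 (system_output G w)) \<and>
    M0 G = (SUP w\<in>{w \<in> L1_signals. nonzero_signal w}.
              norm_inf2 (system_output G w) / ereal (norm_12 w))"
proof -
  obtain K where "\<And>t. t \<ge> 0 \<Longrightarrow> norm (G t) \<le> K"
    using stable_impulse_response_bounded[OF assms(1), of B C] assms(2) by blast
  moreover have "continuous_on {0..} G"
    unfolding assms(2) by (rule continuous_on_impulse_response)
  ultimately show ?thesis
    using M0_induced_norm[of G K] by blast
qed

end
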